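(* Let $J$ be a finite set. Endow $\mathcal G^\bullet(\mathbb C^J)$ with the local topology and $\mathrm{Traf}^\bullet\langle J\rangle$ with the topology of pointwise convergence. Then the map $\hat\tau:\mathcal G^\bullet(\mathbb C^J)\to\mathrm{Traf}^\bullet\langle J\rangle$, $(G,o)\mapsto\tau_{(G,o)}$, is continuous.
   Context: $\mathcal G^\bullet(\mathbb C^J)$ is the set, up to root- and mark-preserving isomorphism, of connected locally finite rooted undirected graphs $(G,o)$, $G=(V,E,\xi)$ with $V$ countable, whose edges $\{u,v\}$ carry marks $\xi(u,v)=(\xi_j(u,v))_{j\in J}\in\mathbb C^J$ with $\xi_j(v,u)=\overline{\xi_j(u,v)}$; set $\xi(u,v)=0$ if $\{u,v\}\notin E$. Local topology: $g_n\to g$ iff for every $r$ and all large $n$ there is a root-preserving isomorphism between the balls of radius $r$ around the roots of the unmarked graphs of $g_n$ and $g$ along which the marks converge uniformly. A rooted test graph labeled in $J$ is a finite connected directed graph $H=(V_H,E_H,\ell,\varepsilon)$, possibly with self-loops and multiple edges, each edge $e$ carrying labels $\ell(e)\in J$, $\varepsilon(e)\in\{1,*\}$, with a root denoted $1\in V_H$. $\mathrm{Traf}^\bullet\langle J\rangle$ is the algebraic dual of the complex vector space with basis the rooted test graphs up to root- and label-preserving isomorphism. The rooted traffic distribution of $(G,o)$ is $$\tau_{(G,o)}[H]=\sum_{\phi:V_H\to V,\ \phi(1)=o}\ \prod_{e=(v,w)\in E_H}\xi^{\varepsilon(e)}_{\ell(e)}(\phi(w),\phi(v)),$$ where $\xi_j^1=\xi_j$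 and $\xi_j^*(x,y)=\overline{\xi_j(y,x)}$ (only finitely many terms are non-zero). *)

theory Defs
  imports
    "HOL-Analysis.Analysis"
    "HOL-Library.Poly_Mapping"
    "Graph_Theory.Digraph_Component"
begin

section \<open>Rooted marked graphs up to isomorphism\<close>

text \<open>
  Every countable graph is isomorphic to one whose vertices form a subset of \<open>nat\<close>, and only
  isomorphism classes matter, so vertices are natural numbers. Edges are sets \<open>{u, v}\<close>; the
  case \<open>u = v\<close> of a loop (whose marks are then real) is not excluded. \<open>mark G j u v\<close> is
  $\xi_j(u,v)$.
\<close>

record 'j marked_graph =
  vertices :: "nat set"
  edges :: "nat set set"
  mark :: "'j \<Rightarrow> nat \<Rightarrow> nat \<Rightarrow> complex"
  root :: nat

definition adj :: "'j marked_graph \<Rightarrow> (nat \<times> nat) set" where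
  "adj G = {(u, v). {u, v} \<in> edges G}"

definition rooted_graphs :: "'j set \<Rightarrow> 'j marked_graph set" where
  "rooted_graphs J = {G.
     root G \<in> vertices G \<and>
     edges G \<subseteq> {{u, v} | u v. u \<in> vertices G \<and> v \<in> vertices G} \<and>
     (\<forall>v\<in>vertices G. finite {e \<in> edges G. v \<in> e}) \<and>
     (\<forall>u\<in>vertices G. \<forall>v\<in>vertices G. (u, v) \<in> (adj G)\<^sup>*) \<and>
     (\<forall>j\<in>J. \<forall>u\<in>vertices G. \<forall>v\<in>vertices G. mark G j v u = cnj (mark G j u v)) \<and>
     (\<forall>j\<in>J. \<forall>u\<in>vertices G. \<forall>v\<in>vertices G. {u, v} \<notin> edges G \<longrightarrow> mark G j u v = 0)}"

definition is_graph_iso ::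
  "'j set \<Rightarrow> 'j marked_graph \<Rightarrow> 'j marked_graph \<Rightarrow> (nat \<Rightarrow> nat) \<Rightarrow> bool" where
  "is_graph_iso J G H \<phi> \<longleftrightarrow>
     bij_betw \<phi> (vertices G) (vertices H) \<and> \<phi> (root G) = root H \<and>
     (\<forall>u\<in>vertices G. \<forall>v\<in>vertices G. {u, v} \<in> edges G \<longleftrightarrow> {\<phi> u, \<phi> v} \<in> edges H) \<and>
     (\<forall>j\<in>J. \<forall>u\<in>vertices G. \<forall>v\<in>vertices G. mark H j (\<phi> u) (\<phi> v) = mark G j u v)"

definition graph_iso :: "'j set \<Rightarrow> ('j marked_graph \<times> 'j marked_graph) set" where
  "graph_iso J =
     {(G, H). G \<in> rooted_graphs J \<and> H \<in> rooted_graphs J \<and> (\<exists>\<phi>. is_graph_iso J G H \<phi>)}"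

definition graph_classes :: "'j set \<Rightarrow> 'j marked_graph set set" where
  "graph_classes J = rooted_graphs J // graph_iso J"


section \<open>The local topology\<close>

definition gball :: "'j marked_graph \<Rightarrow> nat \<Rightarrow> nat set" where
  "gball G r = {v. \<exists>k\<le>r. (root G, v) \<in> adj G ^^ k}"

definition ball_iso ::
  "nat \<Rightarrow> 'j marked_graph \<Rightarrow> 'j marked_graph \<Rightarrow> (nat \<Rightarrow> nat) \<Rightarrow> bool" where
  "ball_iso r G H \<phi> \<longleftrightarrow>
     bij_betw \<phi> (gball G r) (gball H r) \<and> \<phi> (root G) = root H \<and>
     (\<forall>u\<in>gball G r. \<forall>v\<in>gball G r. {u, v} \<in> edges G \<longleftrightarrow> {\<phi> u, \<phi> v} \<in> edges H)"

definition marks_within ::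
  "'j set \<Rightarrow> nat \<Rightarrow> real \<Rightarrow> 'j marked_graph \<Rightarrow> 'j marked_graph \<Rightarrow> (nat \<Rightarrow> nat) \<Rightarrow> bool" where
  "marks_within J r \<epsilon> G H \<phi> \<longleftrightarrow>
     (\<forall>j\<in>J. \<forall>u\<in>gball G r. \<forall>v\<in>gball G r. {u, v} \<in> edges G \<longrightarrow>
        cmod (mark H j (\<phi> u) (\<phi> v) - mark G j u v) < \<epsilon>)"

definition local_nbhd ::
  "'j set \<Rightarrow> 'j marked_graph set \<Rightarrow> nat \<Rightarrow> real \<Rightarrow> 'j marked_graph set set" where
  "local_nbhd J g r \<epsilon> = {h \<in> graph_classes J.
     \<exists>G\<in>g. \<exists>H\<in>h. \<exists>\<phi>. ball_iso r G H \<phi> \<and> marks_within J r \<epsilon> G H \<phi>}"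

text \<open>
  Local convergence of sequences is the convergence of this topology: see
  \<open>limitin_local_topology\<close> below.
\<close>

definition local_topology :: "'j set \<Rightarrow> 'j marked_graph set topology" where
  "local_topology J =
     topology_generated_by {local_nbhd J g r \<epsilon> | g r \<epsilon>. g \<in> graph_classes J \<and> \<epsilon> > 0}"


section \<open>Rooted test graphs and their algebraic dual\<close>

text \<open>
  Self-loops and multiple edges are possible in a \<open>pre_digraph\<close>; an arc \<open>e\<close> is the edge
  \<open>(tail e, head e)\<close>. \<open>tg_star H e\<close> means that $\varepsilon(e) = *$.
\<close>

record 'j test_graph =
  tg_graph :: "(nat, nat) pre_digraph"
  tg_label :: "nat \<Rightarrow> 'j"
  tg_star :: "nat \<Rightarrow> bool"
  tg_root :: nat

definition test_graphs :: "'j set \<Rightarrow> 'j test_graph set" where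
  "test_graphs J = {H.
     fin_digraph (tg_graph H) \<and> Digraph_Component.connected (tg_graph H) \<and>
     tg_root H \<in> verts (tg_graph H) \<and> tg_label H ` arcs (tg_graph H) \<subseteq> J}"

definition is_test_iso ::
  "'j test_graph \<Rightarrow> 'j test_graph \<Rightarrow> (nat \<Rightarrow> nat) \<Rightarrow> (nat \<Rightarrow> nat) \<Rightarrow> bool" where
  "is_test_iso H K \<phi> \<psi> \<longleftrightarrow>
     bij_betw \<phi> (verts (tg_graph H)) (verts (tg_graph K)) \<and>
     bij_betw \<psi> (arcs (tg_graph H)) (arcs (tg_graph K)) \<and>
     \<phi> (tg_root H) = tg_root K \<and>
     (\<forall>e\<in>arcs (tg_graph H).
        tail (tg_graph K) (\<psi> e) = \<phi> (tail (tg_graph H) e) \<and>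
        head (tg_graph K) (\<psi> e) = \<phi> (head (tg_graph H) e) \<and>
        tg_label K (\<psi> e) = tg_label H e \<and>
        tg_star K (\<psi> e) = tg_star H e)"

definition test_iso :: "'j set \<Rightarrow> ('j test_graph \<times> 'j test_graph) set" where
  "test_iso J =
     {(H, K). H \<in> test_graphs J \<and> K \<in> test_graphs J \<and> (\<exists>\<phi> \<psi>. is_test_iso H K \<phi> \<psi>)}"

definition test_classes :: "'j set \<Rightarrow> 'j test_graph set set" where
  "test_classes J = test_graphs J // test_iso J"

definition test_space :: "'j set \<Rightarrow> ('j test_graph set \<Rightarrow>\<^sub>0 complex) set" where
  "test_space J = {p. Poly_Mapping.keys p \<subseteq> test_classes J}"

definition traf_dual :: "'j set \<Rightarrow> (('j test_graph set \<Rightarrow>\<^sub>0 complex) \<Rightarrow> complex) set" where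
  "traf_dual J = {f \<in> extensional (test_space J).
     (\<forall>p\<in>test_space J. \<forall>q\<in>test_space J. f (p + q) = f p + f q) \<and>
     (\<forall>c. \<forall>p\<in>test_space J. f (Poly_Mapping.map ((*) c) p) = c * f p)}"

definition traf_topology ::
  "'j set \<Rightarrow> (('j test_graph set \<Rightarrow>\<^sub>0 complex) \<Rightarrow> complex) topology" where
  "traf_topology J = subtopology (product_topology (\<lambda>_. euclidean) (test_space J)) (traf_dual J)"


section \<open>The rooted traffic distribution\<close>

definition mark_eps :: "'j marked_graph \<Rightarrow> bool \<Rightarrow> 'j \<Rightarrow> nat \<Rightarrow> nat \<Rightarrow> complex" where
  "mark_eps G s j x y = (if s then cnj (mark G j y x) else mark G j x y)"

text \<open>
  The maps \<open>\<phi>\<close> range over a possibly infinite set, but only finitely many terms are non-zero,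
  so the \<open>infsum\<close> is a finite sum.
\<close>

definition rooted_tau :: "'j marked_graph \<Rightarrow> 'j test_graph \<Rightarrow> complex" where
  "rooted_tau G H =
     (\<Sum>\<^sub>\<infinity>\<phi>\<in>{\<phi> \<in> verts (tg_graph H) \<rightarrow>\<^sub>E vertices G. \<phi> (tg_root H) = root G}.
        \<Prod>e\<in>arcs (tg_graph H).
          mark_eps G (tg_star H e) (tg_label H e)
            (\<phi> (head (tg_graph H) e)) (\<phi> (tail (tg_graph H) e)))"

text \<open>
  The value does not depend on the chosen representatives, see \<open>rooted_tau_iso\<close> below.
\<close>

definition tau_class :: "'j marked_graph set \<Rightarrow> 'j test_graph set \<Rightarrow> complex" where
  "tau_class g h = rooted_tau (SOME G. G \<in> g) (SOME H. H \<in> h)"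

definition tau_hat ::
  "'j set \<Rightarrow> 'j marked_graph set \<Rightarrow> ('j test_graph set \<Rightarrow>\<^sub>0 complex) \<Rightarrow> complex" where
  "tau_hat J g =
     (\<lambda>p\<in>test_space J. \<Sum>h\<in>Poly_Mapping.keys p. Poly_Mapping.lookup p h * tau_class g h)"



section \<open>Independence of representatives\<close>

lemma is_graph_iso_id: "is_graph_iso J G G (\<lambda>x. x)"
  by (simp add: is_graph_iso_def bij_betw_def inj_on_def)

lemma is_graph_iso_inv:
  assumes "is_graph_iso J G H \<phi>" and "root G \<in> vertices G"
  shows "is_graph_iso J H G (inv_into (vertices G) \<phi>)"
proof -
  let ?i = "inv_into (vertices G) \<phi>"
  have b: "bij_betw \<phi> (vertices G) (vertices H)" using assms by (simp add: is_graph_iso_def)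
  have i: "?i x \<in> vertices G" "\<phi> (?i x) = x" if "x \<in> vertices H" for x
    using that b by (auto simp: bij_betw_def inv_into_into f_inv_into_f)
  have r: "?i (root H) = root G"
    using assms b by (metis bij_betw_inv_into_left is_graph_iso_def)
  have e: "{x, y} \<in> edges H \<longleftrightarrow> {?i x, ?i y} \<in> edges G"
    and m: "j \<in> J \<Longrightarrow> mark G j (?i x) (?i y) = mark H j x y"
    if "x \<in> vertices H" "y \<in> vertices H" for x y j
  proof -
    have "{?i x, ?i y} \<in> edges G \<longleftrightarrow> {\<phi> (?i x), \<phi> (?i y)} \<in> edges H"
      "j \<in> J \<Longrightarrow> mark H j (\<phi> (?i x)) (\<phi> (?i y)) = mark G j (?i x) (?i y)"
      using assms(1) i(1) that unfolding is_graph_iso_def by blast+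
    then show "{x, y} \<in> edges H \<longleftrightarrow> {?i x, ?i y} \<in> edges G"
      "j \<in> J \<Longrightarrow> mark G j (?i x) (?i y) = mark H j x y"
      using i(2) that by simp_all
  qed
  show ?thesis
    unfolding is_graph_iso_def using r bij_betw_inv_into[OF b] e m by blast
qed

lemma is_graph_iso_comp:
  assumes "is_graph_iso J G H \<phi>" "is_graph_iso J H K \<psi>"
  shows "is_graph_iso J G K (\<psi> \<circ> \<phi>)"
proof -
  have "\<phi> u \<in> vertices H" if "u \<in> vertices G" for u
    using assms(1) that by (auto simp: is_graph_iso_def bij_betw_def)
  then show ?thesis
    using assms bij_betw_trans[of \<phi> "vertices G" "vertices H" \<psi>] by (simp add: is_graph_iso_def)
qed

lemma equiv_graph_iso: "equiv (rooted_graphs J) (graph_iso J)"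
proof (rule equivI)
  show "graph_iso J \<subseteq> rooted_graphs J \<times> rooted_graphs J"
    by (auto simp: graph_iso_def)
  show "refl_on (rooted_graphs J) (graph_iso J)"
    using is_graph_iso_id unfolding refl_on_def graph_iso_def by blast
  show "sym (graph_iso J)"
  proof (rule symI)
    fix G H assume "(G, H) \<in> graph_iso J"
    then obtain \<phi> where "G \<in> rooted_graphs J" "H \<in> rooted_graphs J" "is_graph_iso J G H \<phi>"
      unfolding graph_iso_def by blast
    moreover from this have "root G \<in> vertices G" unfolding rooted_graphs_def by blast
    ultimately show "(H, G) \<in> graph_iso J"
      using is_graph_iso_inv unfolding graph_iso_def by blast
  qed
  show "trans (graph_iso J)"
    using is_graph_iso_comp unfolding graph_iso_def trans_def by blast
qed

lemma is_test_iso_id: "is_test_iso H H (\<lambda>x. x) (\<lambda>x. x)"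
  by (simp add: is_test_iso_def bij_betw_def inj_on_def)

lemma is_test_iso_inv:
  assumes "is_test_iso H K \<phi> \<psi>" and "H \<in> test_graphs J"
  shows "is_test_iso K H (inv_into (verts (tg_graph H)) \<phi>) (inv_into (arcs (tg_graph H)) \<psi>)"
proof -
  let ?i = "inv_into (verts (tg_graph H)) \<phi>" and ?k = "inv_into (arcs (tg_graph H)) \<psi>"
  interpret fin_digraph "tg_graph H" using assms(2) by (simp add: test_graphs_def)
  have b: "bij_betw \<phi> (verts (tg_graph H)) (verts (tg_graph K))"
    and c: "bij_betw \<psi> (arcs (tg_graph H)) (arcs (tg_graph K))"
    using assms by (simp_all add: is_test_iso_def)
  have li: "?i (\<phi> x) = x" if "x \<in> verts (tg_graph H)" for x
    using that b by (simp add: bij_betw_inv_into_left)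
  have k: "?k e \<in> arcs (tg_graph H)" "\<psi> (?k e) = e" if "e \<in> arcs (tg_graph K)" for e
    using that c by (auto simp: bij_betw_def inv_into_into f_inv_into_f)
  have r: "?i (tg_root K) = tg_root H"
    using assms li[of "tg_root H"] by (simp add: is_test_iso_def test_graphs_def)
  have "tail (tg_graph H) (?k e) = ?i (tail (tg_graph K) e) \<and>
      head (tg_graph H) (?k e) = ?i (head (tg_graph K) e) \<and>
      tg_label H (?k e) = tg_label K e \<and> tg_star H (?k e) = tg_star K e"
    if e: "e \<in> arcs (tg_graph K)" for e
  proof -
    note k = k[OF e]
    have "tail (tg_graph K) (\<psi> (?k e)) = \<phi> (tail (tg_graph H) (?k e)) \<and>
        head (tg_graph K) (\<psi> (?k e)) = \<phi> (head (tg_graph H) (?k e)) \<and>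
        tg_label K (\<psi> (?k e)) = tg_label H (?k e) \<and> tg_star K (\<psi> (?k e)) = tg_star H (?k e)"
      using assms(1) k(1) unfolding is_test_iso_def by blast
    then show ?thesis using k li[OF tail_in_verts[OF k(1)]] li[OF head_in_verts[OF k(1)]] by simp
  qed
  then show ?thesis
    unfolding is_test_iso_def using r bij_betw_inv_into[OF b] bij_betw_inv_into[OF c] by blast
qed

lemma is_test_iso_comp:
  assumes "is_test_iso H K \<phi> \<psi>" "is_test_iso K L \<phi>' \<psi>'"
  shows "is_test_iso H L (\<phi>' \<circ> \<phi>) (\<psi>' \<circ> \<psi>)"
proof -
  have "\<psi> u \<in> arcs (tg_graph K)" if "u \<in> arcs (tg_graph H)" for u
    using assms(1) that by (auto simp: is_test_iso_def bij_betw_def)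
  then show ?thesis
    using assms bij_betw_trans[of \<phi> "verts (tg_graph H)" "verts (tg_graph K)" \<phi>']
      bij_betw_trans[of \<psi> "arcs (tg_graph H)" "arcs (tg_graph K)" \<psi>']
    by (simp add: is_test_iso_def)
qed

lemma equiv_test_iso: "equiv (test_graphs J) (test_iso J)"
proof (rule equivI)
  show "test_iso J \<subseteq> test_graphs J \<times> test_graphs J"
    by (auto simp: test_iso_def)
  show "refl_on (test_graphs J) (test_iso J)"
    using is_test_iso_id unfolding refl_on_def test_iso_def by blast
  show "sym (test_iso J)"
    using is_test_iso_inv unfolding test_iso_def sym_def by blast
  show "trans (test_iso J)"
    using is_test_iso_comp unfolding test_iso_def trans_def by blast
qed

lemma rooted_tau_graph_iso:
  assumes iso: "is_graph_iso J G G' f" and root: "root G \<in> vertices G" and H: "H \<in> test_graphs J"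
  shows "rooted_tau G H = rooted_tau G' H"
proof -
  interpret fin_digraph "tg_graph H" using H by (simp add: test_graphs_def)
  let ?V = "verts (tg_graph H)"
  let ?g = "inv_into (vertices G) f"
  have iso': "is_graph_iso J G' G ?g" using is_graph_iso_inv[OF iso root] .
  have b: "bij_betw f (vertices G) (vertices G')" using iso by (simp add: is_graph_iso_def)
  have gf: "?g (f x) = x" if "x \<in> vertices G" for x
    using that b by (simp add: bij_betw_inv_into_left)
  have fg: "f (?g x) = x" if "x \<in> vertices G'" for x
    using that b by (simp add: bij_betw_inv_into_right)
  have fV: "f x \<in> vertices G'" if "x \<in> vertices G" for x
    using that b by (auto simp: bij_betw_def)
  have gV: "?g x \<in> vertices G" if "x \<in> vertices G'" for x
    using that iso' by (auto simp: is_graph_iso_def bij_betw_def)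
  have r: "f (root G) = root G'" "?g (root G') = root G"
    using iso iso' by (simp_all add: is_graph_iso_def)
  have m: "mark G' j (f u) (f v) = mark G j u v" if "j \<in> J" "u \<in> vertices G" "v \<in> vertices G" for j u v
    using iso that by (simp add: is_graph_iso_def)
  have rH: "tg_root H \<in> ?V" and lab: "\<And>e. e \<in> arcs (tg_graph H) \<Longrightarrow> tg_label H e \<in> J"
    using H by (auto simp: test_graphs_def)
  show ?thesis
    unfolding rooted_tau_def
  proof (rule infsum_reindex_bij_witness
      [where j = "\<lambda>\<phi>. restrict (f \<circ> \<phi>) ?V" and i = "\<lambda>\<phi>. restrict (?g \<circ> \<phi>) ?V"], goal_cases)
    case (1 a)
    then show ?case by (auto simp: fun_eq_iff restrict_def PiE_def Pi_def extensional_def gf)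
  next
    case (2 a)
    then show ?case using rH r fV by (auto simp: PiE_def Pi_def)
  next
    case (3 a)
    then show ?case by (auto simp: fun_eq_iff restrict_def PiE_def Pi_def extensional_def fg)
  next
    case (4 a)
    then show ?case using rH r gV by (auto simp: PiE_def Pi_def)
  next
    case (5 a)
    then show ?case using lab by (intro prod.cong) (auto simp: PiE_def Pi_def mark_eps_def m)
  qed
qed

lemma rooted_tau_test_iso:
  assumes iso: "is_test_iso H K \<phi> \<psi>" and H: "H \<in> test_graphs J"
  shows "rooted_tau G H = rooted_tau G K"
proof -
  interpret fin_digraph "tg_graph H" using H by (simp add: test_graphs_def)
  let ?V = "verts (tg_graph H)" and ?W = "verts (tg_graph K)"
  let ?i = "inv_into ?V \<phi>"
  have b: "bij_betw \<phi> ?V ?W" and c: "bij_betw \<psi> (arcs (tg_graph H)) (arcs (tg_graph K))"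
    using iso by (simp_all add: is_test_iso_def)
  have li: "?i (\<phi> x) = x" if "x \<in> ?V" for x
    using that b by (simp add: bij_betw_inv_into_left)
  have ri: "\<phi> (?i x) = x" if "x \<in> ?W" for x
    using that b by (simp add: bij_betw_inv_into_right)
  have V: "\<phi> x \<in> ?W" if "x \<in> ?V" for x
    using that b by (auto simp: bij_betw_def)
  have W: "?i x \<in> ?V" if "x \<in> ?W" for x
    using that b by (auto simp: bij_betw_def inv_into_into)
  have rH: "tg_root H \<in> ?V" using H by (simp add: test_graphs_def)
  have r: "\<phi> (tg_root H) = tg_root K" using iso by (simp add: is_test_iso_def)
  have r': "?i (tg_root K) = tg_root H" "tg_root K \<in> ?W" using r rH li V by fastforce+
  show ?thesis
    unfolding rooted_tau_def
  proof (rule infsum_reindex_bij_witness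
      [where j = "\<lambda>a. restrict (a \<circ> ?i) ?W" and i = "\<lambda>a. restrict (a \<circ> \<phi>) ?V"], goal_cases)
    case (1 a)
    then show ?case using V by (auto simp: fun_eq_iff restrict_def PiE_def Pi_def extensional_def li)
  next
    case (2 a)
    then show ?case using W r' by (auto simp: PiE_def Pi_def)
  next
    case (3 a)
    then show ?case using W by (auto simp: fun_eq_iff restrict_def PiE_def Pi_def extensional_def ri)
  next
    case (4 a)
    then show ?case using V r rH by (auto simp: PiE_def Pi_def)
  next
    case (5 a)
    then show ?case
      using iso by (subst prod.reindex_bij_betw[OF c, symmetric])
        (intro prod.cong; simp add: is_test_iso_def V li)
  qed
qed

lemma rooted_tau_iso:
  assumes "(G, G') \<in> graph_iso J" "(H, H') \<in> test_iso J"
  shows "rooted_tau G H = rooted_tau G' H'"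
proof -
  obtain f where f: "is_graph_iso J G G' f" and G: "G \<in> rooted_graphs J"
    using assms(1) unfolding graph_iso_def by blast
  obtain \<phi> \<psi> where H: "is_test_iso H H' \<phi> \<psi>" "H \<in> test_graphs J" "H' \<in> test_graphs J"
    using assms(2) unfolding test_iso_def by blast
  have "root G \<in> vertices G" using G unfolding rooted_graphs_def by blast
  then have "rooted_tau G H' = rooted_tau G' H'" using rooted_tau_graph_iso f H(3) by blast
  then show ?thesis using rooted_tau_test_iso[OF H(1,2), of G] by simp
qed

lemma tau_class_eq:
  assumes "g \<in> graph_classes J" "G \<in> g" "h \<in> test_classes J" "H \<in> h"
  shows "tau_class g h = rooted_tau G H"
  unfolding tau_class_def
proof (rule rooted_tau_iso)
  show "(SOME G. G \<in> g, G) \<in> graph_iso J"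
    using assms(1,2) someI[of "\<lambda>G. G \<in> g", OF assms(2)] unfolding graph_classes_def
    by (intro quotient_eq_iff[OF equiv_graph_iso, THEN iffD1]) auto
  show "(SOME H. H \<in> h, H) \<in> test_iso J"
    using assms(3,4) someI[of "\<lambda>H. H \<in> h", OF assms(4)] unfolding test_classes_def
    by (intro quotient_eq_iff[OF equiv_test_iso, THEN iffD1]) auto
qed


section \<open>Convergence in the local topology\<close>

lemma rooted_graphsD:
  assumes "G \<in> rooted_graphs J"
  shows "root G \<in> vertices G" "(u, v) \<in> adj G \<Longrightarrow> u \<in> vertices G \<and> v \<in> vertices G"
    "v \<in> vertices G \<Longrightarrow> finite {e \<in> edges G. v \<in> e}"
proof -
  show "root G \<in> vertices G" "v \<in> vertices G \<Longrightarrow> finite {e \<in> edges G. v \<in> e}"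
    using assms unfolding rooted_graphs_def by blast+
  have E: "edges G \<subseteq> {{u, v} | u v. u \<in> vertices G \<and> v \<in> vertices G}"
    using assms unfolding rooted_graphs_def by blast
  assume "(u, v) \<in> adj G"
  then have "{u, v} \<in> edges G" by (simp add: adj_def)
  then obtain x y where "{u, v} = {x, y}" "x \<in> vertices G" "y \<in> vertices G" using E by blast
  then show "u \<in> vertices G \<and> v \<in> vertices G" by (auto simp: doubleton_eq_iff)
qed

lemma relpow_vertices:
  assumes "G \<in> rooted_graphs J" "(root G, v) \<in> adj G ^^ k"
  shows "v \<in> vertices G"
  using assms(2) rooted_graphsD(1,2)[OF assms(1)] by (cases k) auto

lemma gball_subset: "G \<in> rooted_graphs J \<Longrightarrow> gball G r \<subseteq> vertices G"
  by (auto simp: gball_def dest: relpow_vertices)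

lemma root_in_gball [simp]: "root G \<in> gball G r"
  by (auto simp: gball_def intro!: exI[of _ 0])

lemma gball_mono: "r \<le> s \<Longrightarrow> gball G r \<subseteq> gball G s"
  by (auto simp: gball_def intro: order_trans)

lemma finite_gball:
  assumes "G \<in> rooted_graphs J"
  shows "finite (gball G r)"
proof -
  have fin: "finite {v. (root G, v) \<in> adj G ^^ k}" for k
  proof (induction k)
    case (Suc k)
    have "finite {w. (v, w) \<in> adj G}" if "(root G, v) \<in> adj G ^^ k" for v
    proof -
      have "v \<in> vertices G" using relpow_vertices[OF assms that] .
      then have f: "finite {e \<in> edges G. v \<in> e}" using rooted_graphsD(3)[OF assms] by simp
      have E: "edges G \<subseteq> {{u, v} | u v. u \<in> vertices G \<and> v \<in> vertices G}"
        using assms unfolding rooted_graphs_def by blast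
      have "finite e" if "e \<in> {e \<in> edges G. v \<in> e}" for e using that E by auto
      then have "finite (\<Union>{e \<in> edges G. v \<in> e})" using f by (intro finite_Union)
      moreover have "{w. (v, w) \<in> adj G} \<subseteq> \<Union>{e \<in> edges G. v \<in> e}" by (auto simp: adj_def)
      ultimately show ?thesis by (rule rev_finite_subset)
    qed
    then have "finite (\<Union>v\<in>{v. (root G, v) \<in> adj G ^^ k}. {w. (v, w) \<in> adj G})"
      using Suc by auto
    then show ?case by (rule rev_finite_subset) auto
  qed simp
  have "gball G r = (\<Union>k\<in>{..r}. {v. (root G, v) \<in> adj G ^^ k})" by (auto simp: gball_def)
  then show ?thesis using fin by simp
qed

lemma ball_iso_id: "ball_iso r G G (\<lambda>x. x)"
  by (simp add: ball_iso_def bij_betw_def inj_on_def)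

lemma ball_iso_inv:
  assumes "ball_iso r G H \<phi>"
  shows "ball_iso r H G (inv_into (gball G r) \<phi>)"
proof -
  let ?i = "inv_into (gball G r) \<phi>"
  have b: "bij_betw \<phi> (gball G r) (gball H r)" using assms by (simp add: ball_iso_def)
  have i: "?i x \<in> gball G r" "\<phi> (?i x) = x" if "x \<in> gball H r" for x
    using that b by (auto simp: bij_betw_def inv_into_into f_inv_into_f)
  have r: "?i (root H) = root G"
    using assms b by (metis bij_betw_inv_into_left ball_iso_def root_in_gball)
  have "{x, y} \<in> edges H \<longleftrightarrow> {?i x, ?i y} \<in> edges G"
    if "x \<in> gball H r" "y \<in> gball H r" for x y
  proof -
    have "{?i x, ?i y} \<in> edges G \<longleftrightarrow> {\<phi> (?i x), \<phi> (?i y)} \<in> edges H"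
      using assms(1) i(1) that unfolding ball_iso_def by blast
    then show ?thesis using i(2) that by simp
  qed
  then show ?thesis
    unfolding ball_iso_def using r bij_betw_inv_into[OF b] by blast
qed

lemma ball_iso_comp:
  assumes "ball_iso r G H \<phi>" "ball_iso r H K \<psi>"
  shows "ball_iso r G K (\<psi> \<circ> \<phi>)"
proof -
  have "\<phi> u \<in> gball H r" if "u \<in> gball G r" for u
    using assms(1) that by (auto simp: ball_iso_def bij_betw_def)
  then show ?thesis
    using assms bij_betw_trans[of \<phi> "gball G r" "gball H r" \<psi>] by (simp add: ball_iso_def)
qed

lemma ball_iso_relpow:
  assumes "ball_iso r G H \<phi>" "k \<le> r" "(root G, v) \<in> adj G ^^ k"
  shows "(root H, \<phi> v) \<in> adj H ^^ k"
  using assms(2,3)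
proof (induction k arbitrary: v)
  case 0
  then show ?case using assms(1) by (simp add: ball_iso_def)
next
  case (Suc k)
  then obtain w where w: "(root G, w) \<in> adj G ^^ k" "(w, v) \<in> adj G" by auto
  have "k \<le> r" using Suc.prems(1) by simp
  then have "w \<in> gball G r" "v \<in> gball G r"
    using Suc.prems w(1) unfolding gball_def by blast+
  then have "(\<phi> w, \<phi> v) \<in> adj H" using w assms(1) by (simp add: ball_iso_def adj_def)
  then show ?case using Suc w by auto
qed

lemma ball_iso_image:
  assumes "ball_iso r G H \<phi>" "s \<le> r"
  shows "\<phi> ` gball G s = gball H s"
proof
  show "\<phi> ` gball G s \<subseteq> gball H s"
    using ball_iso_relpow[OF assms(1)] assms(2) by (fastforce simp: gball_def)
  let ?i = "inv_into (gball G r) \<phi>"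
  show "gball H s \<subseteq> \<phi> ` gball G s"
  proof
    fix v assume v: "v \<in> gball H s"
    then have "?i v \<in> gball G s"
      using ball_iso_relpow[OF ball_iso_inv[OF assms(1)]] assms(2) by (fastforce simp: gball_def)
    moreover have "\<phi> (?i v) = v"
      using v gball_mono[OF assms(2), of H] assms(1) bij_betw_inv_into_right
      by (fastforce simp: ball_iso_def)
    ultimately show "v \<in> \<phi> ` gball G s" by force
  qed
qed

lemma ball_iso_mono:
  assumes "ball_iso r G H \<phi>" "s \<le> r"
  shows "ball_iso s G H \<phi>"
proof -
  have "bij_betw \<phi> (gball G s) (gball H s)"
    using assms ball_iso_image[OF assms] gball_mono[OF assms(2), of G]
    by (auto simp: ball_iso_def bij_betw_def intro: inj_on_subset)
  then show ?thesis using assms gball_mono[OF assms(2), of G] unfolding ball_iso_def by blast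
qed

lemma marks_within_mono:
  assumes "marks_within J r \<delta> G H \<phi>" "s \<le> r" "\<delta> \<le> \<epsilon>"
  shows "marks_within J s \<epsilon> G H \<phi>"
  unfolding marks_within_def
proof (intro ballI impI)
  fix j u v assume "j \<in> J" "u \<in> gball G s" "v \<in> gball G s" "{u, v} \<in> edges G"
  then have "cmod (mark H j (\<phi> u) (\<phi> v) - mark G j u v) < \<delta>"
    using assms(1) gball_mono[OF assms(2), of G] unfolding marks_within_def by blast
  then show "cmod (mark H j (\<phi> u) (\<phi> v) - mark G j u v) < \<epsilon>" using assms(3) by simp
qed

lemma marks_within_comp:
  assumes "ball_iso r G H \<phi>" "marks_within J r \<delta> G H \<phi>" "marks_within J r \<epsilon> H K \<psi>"
  shows "marks_within J r (\<delta> + \<epsilon>) G K (\<psi> \<circ> \<phi>)"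
  unfolding marks_within_def
proof (intro ballI impI)
  fix j u v assume *: "j \<in> J" "u \<in> gball G r" "v \<in> gball G r" "{u, v} \<in> edges G"
  then have "cmod (mark H j (\<phi> u) (\<phi> v) - mark G j u v) < \<delta>"
    using assms(2) by (simp add: marks_within_def)
  moreover have "\<phi> u \<in> gball H r" "\<phi> v \<in> gball H r" "{\<phi> u, \<phi> v} \<in> edges H"
    using assms(1) * by (auto simp: ball_iso_def bij_betw_def)
  then have "cmod (mark K j (\<psi> (\<phi> u)) (\<psi> (\<phi> v)) - mark H j (\<phi> u) (\<phi> v)) < \<epsilon>"
    using assms(3) * by (simp add: marks_within_def)
  ultimately show "cmod (mark K j ((\<psi> \<circ> \<phi>) u) ((\<psi> \<circ> \<phi>) v) - mark G j u v) < \<delta> + \<epsilon>"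
    using norm_triangle_lt[of "mark K j (\<psi> (\<phi> u)) (\<psi> (\<phi> v)) - mark H j (\<phi> u) (\<phi> v)"
        "mark H j (\<phi> u) (\<phi> v) - mark G j u v" "\<delta> + \<epsilon>"] by simp
qed

lemma graph_iso_ball_iso:
  assumes "(G, H) \<in> graph_iso J" "\<epsilon> > 0"
  obtains \<phi> where "ball_iso r G H \<phi>" "marks_within J r \<epsilon> G H \<phi>"
proof -
  obtain \<phi> where \<phi>: "is_graph_iso J G H \<phi>" and G: "G \<in> rooted_graphs J" and H: "H \<in> rooted_graphs J"
    using assms(1) by (auto simp: graph_iso_def)
  have step: "(root H', \<psi> v) \<in> adj H' ^^ k"
    if iso: "is_graph_iso J G' H' \<psi>" and G': "G' \<in> rooted_graphs J"
      and "(root G', v) \<in> adj G' ^^ k" for G' H' :: "'a marked_graph" and \<psi> v k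
    using that(3)
  proof (induction k arbitrary: v)
    case 0
    then show ?case using iso by (simp add: is_graph_iso_def)
  next
    case (Suc k)
    then obtain w where w: "(root G', w) \<in> adj G' ^^ k" "(w, v) \<in> adj G'" by auto
    then have "(\<psi> w, \<psi> v) \<in> adj H'"
      using iso rooted_graphsD(2)[OF G' w(2)] by (simp add: is_graph_iso_def adj_def)
    then show ?case using Suc w by auto
  qed
  let ?i = "inv_into (vertices G) \<phi>"
  have i: "is_graph_iso J H G ?i" using is_graph_iso_inv[OF \<phi>] rooted_graphsD(1)[OF G] .
  have b: "bij_betw \<phi> (vertices G) (vertices H)" using \<phi> by (simp add: is_graph_iso_def)
  have "\<phi> ` gball G r = gball H r"
  proof
    show "\<phi> ` gball G r \<subseteq> gball H r" using step[OF \<phi> G] by (fastforce simp: gball_def)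
    show "gball H r \<subseteq> \<phi> ` gball G r"
    proof
      fix v assume v: "v \<in> gball H r"
      then have "?i v \<in> gball G r" using step[OF i H] by (fastforce simp: gball_def)
      moreover have "\<phi> (?i v) = v"
        using v gball_subset[OF H] b bij_betw_inv_into_right by fastforce
      ultimately show "v \<in> \<phi> ` gball G r" by force
    qed
  qed
  then have "ball_iso r G H \<phi>"
    using b \<phi> gball_subset[OF G, of r] inj_on_subset
    unfolding ball_iso_def is_graph_iso_def bij_betw_def by (simp add: subset_iff) blast
  moreover have "marks_within J r \<epsilon> G H \<phi>"
    using \<phi> gball_subset[OF G, of r] assms(2)
    unfolding marks_within_def is_graph_iso_def by (simp add: subset_iff)
  ultimately show ?thesis using that by blast
qed

lemma marks_within_slack:
  assumes "finite J" "G \<in> rooted_graphs J" "marks_within J r \<epsilon> G H \<phi>" "\<epsilon> > 0"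
  obtains \<delta> where "\<delta> > 0" "\<delta> < \<epsilon>" "marks_within J r (\<epsilon> - \<delta>) G H \<phi>"
proof -
  let ?d = "\<lambda>(j, u, v). cmod (mark H j (\<phi> u) (\<phi> v) - mark G j u v)"
  let ?S = "{(j, u, v). j \<in> J \<and> u \<in> gball G r \<and> v \<in> gball G r \<and> {u, v} \<in> edges G}"
  have "?S \<subseteq> J \<times> gball G r \<times> gball G r" by auto
  then have "finite ?S"
    using assms(1) finite_gball[OF assms(2)] by (meson finite_SigmaI finite_subset)
  define m where "m = Max (insert 0 (?d ` ?S))"
  have fin: "finite (insert 0 (?d ` ?S))" using \<open>finite ?S\<close> by simp
  have "m < \<epsilon>" unfolding m_def
    using fin assms(3,4) by (subst Max_less_iff) (auto simp: marks_within_def)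
  moreover have "m \<ge> 0" unfolding m_def using fin by simp
  moreover have "marks_within J r (\<epsilon> - (\<epsilon> - m) / 2) G H \<phi>"
    unfolding marks_within_def
  proof (intro ballI impI)
    fix j u v assume "j \<in> J" "u \<in> gball G r" "v \<in> gball G r" "{u, v} \<in> edges G"
    then have "?d (j, u, v) \<le> m" unfolding m_def by (intro Max_ge fin) (auto intro!: image_eqI)
    then show "cmod (mark H j (\<phi> u) (\<phi> v) - mark G j u v) < \<epsilon> - (\<epsilon> - m) / 2"
      using \<open>m < \<epsilon>\<close> by (simp add: field_simps)
  qed
  ultimately show ?thesis using that[of "(\<epsilon> - m) / 2"] by (simp add: field_simps)
qed

lemma class_mem:
  "G \<in> rooted_graphs J \<Longrightarrow> graph_iso J `` {G} \<in> graph_classes J"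
  "G \<in> rooted_graphs J \<Longrightarrow> G \<in> graph_iso J `` {G}"
  using equiv_class_self[OF equiv_graph_iso] by (auto simp: graph_classes_def quotientI)

lemma local_nbhd_class_iff:
  assumes "finite J" "G \<in> rooted_graphs J" "H \<in> rooted_graphs J" "\<epsilon> > 0"
  shows "graph_iso J `` {H} \<in> local_nbhd J (graph_iso J `` {G}) r \<epsilon> \<longleftrightarrow>
           (\<exists>\<phi>. ball_iso r G H \<phi> \<and> marks_within J r \<epsilon> G H \<phi>)"
proof
  assume "graph_iso J `` {H} \<in> local_nbhd J (graph_iso J `` {G}) r \<epsilon>"
  then obtain G' H' \<phi> where G': "(G, G') \<in> graph_iso J" and H': "(H, H') \<in> graph_iso J"
    and \<phi>: "ball_iso r G' H' \<phi>" "marks_within J r \<epsilon> G' H' \<phi>"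
    by (auto simp: local_nbhd_def)
  have "G' \<in> rooted_graphs J" using G' by (simp add: graph_iso_def)
  then obtain \<delta> where \<delta>: "\<delta> > 0" "\<delta> < \<epsilon>" "marks_within J r (\<epsilon> - \<delta>) G' H' \<phi>"
    using marks_within_slack[OF assms(1) _ \<phi>(2) assms(4)] by blast
  obtain \<alpha> where \<alpha>: "ball_iso r G G' \<alpha>" "marks_within J r (\<delta>/2) G G' \<alpha>"
    using graph_iso_ball_iso[OF G', of "\<delta>/2"] \<delta> by auto
  have "(H', H) \<in> graph_iso J" using H' equiv_graph_iso by (meson equivE symE)
  then obtain \<beta> where \<beta>: "ball_iso r H' H \<beta>" "marks_within J r (\<delta>/2) H' H \<beta>"
    using graph_iso_ball_iso[of H' H J "\<delta>/2"] \<delta> by auto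
  have "ball_iso r G H (\<beta> \<circ> (\<phi> \<circ> \<alpha>))"
    using \<alpha> \<beta> \<phi> ball_iso_comp by blast
  moreover have "marks_within J r ((\<delta>/2 + (\<epsilon> - \<delta>)) + \<delta>/2) G H (\<beta> \<circ> (\<phi> \<circ> \<alpha>))"
    using \<alpha> \<beta> \<phi> \<delta> ball_iso_comp by (intro marks_within_comp[where H = H'] marks_within_comp[where H = G']) blast+
  ultimately show "\<exists>\<phi>. ball_iso r G H \<phi> \<and> marks_within J r \<epsilon> G H \<phi>" by auto
next
  assume "\<exists>\<phi>. ball_iso r G H \<phi> \<and> marks_within J r \<epsilon> G H \<phi>"
  then show "graph_iso J `` {H} \<in> local_nbhd J (graph_iso J `` {G}) r \<epsilon>"
    unfolding local_nbhd_def
    using class_mem(1)[OF assms(3)] class_mem(2)[OF assms(2)] class_mem(2)[OF assms(3)] by blast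
qed

lemma topspace_local_topology [simp]: "topspace (local_topology J) = graph_classes J"
proof -
  have "g \<in> local_nbhd J g 0 1" if "g \<in> graph_classes J" for g
  proof -
    have "g \<noteq> {}"
      using that in_quotient_imp_non_empty[OF equiv_graph_iso] by (simp add: graph_classes_def)
    then obtain G where "G \<in> g" by blast
    moreover have "marks_within J 0 1 G G (\<lambda>x. x)" by (simp add: marks_within_def)
    ultimately show ?thesis using that ball_iso_id unfolding local_nbhd_def by blast
  qed
  moreover have "local_nbhd J g r \<epsilon> \<subseteq> graph_classes J" for g r \<epsilon> by (auto simp: local_nbhd_def)
  ultimately show ?thesis
    unfolding local_topology_def topology_generated_by_topspace
    using zero_less_one by blast
qed

lemma local_topology_nbhd_base:
  assumes J: "finite J" and "openin (local_topology J) U" "g \<in> U"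
  shows "\<exists>r. \<exists>\<epsilon>>0. local_nbhd J g r \<epsilon> \<subseteq> U"
proof -
  have rep: "\<exists>G\<in>rooted_graphs J. g = graph_iso J `` {G}" if "g \<in> graph_classes J" for g
    using that by (auto simp: graph_classes_def quotient_def)
  have mono: "local_nbhd J g r \<delta> \<subseteq> local_nbhd J g s \<epsilon>" if "s \<le> r" "\<delta> \<le> \<epsilon>" for g r s \<delta> \<epsilon>
    using that ball_iso_mono marks_within_mono unfolding local_nbhd_def by blast
  have "generate_topology_on {local_nbhd J g r \<epsilon> | g r \<epsilon>. g \<in> graph_classes J \<and> \<epsilon> > 0} U"
    using assms(2) by (simp add: local_topology_def openin_topology_generated_by_iff)
  then show ?thesis
    using assms(3)
  proof (induction arbitrary: g rule: generate_topology_on.induct)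
    case Empty
    then show ?case by simp
  next
    case (Int a b)
    then obtain r \<epsilon> s \<delta> where "\<epsilon> > 0" "\<delta> > 0" "local_nbhd J g r \<epsilon> \<subseteq> a" "local_nbhd J g s \<delta> \<subseteq> b"
      by blast
    then have "min \<epsilon> \<delta> > 0" "local_nbhd J g (max r s) (min \<epsilon> \<delta>) \<subseteq> a \<inter> b"
      using mono[of r "max r s" "min \<epsilon> \<delta>" \<epsilon> g] mono[of s "max r s" "min \<epsilon> \<delta>" \<delta> g] by auto
    then show ?case by blast
  next
    case (UN K)
    then obtain k where k: "k \<in> K" "g \<in> k" by blast
    then obtain r \<epsilon> where "\<epsilon> > 0" "local_nbhd J g r \<epsilon> \<subseteq> k" using UN by blast
    then show ?case using k by blast
  next
    case (Basis s)
    then obtain h r \<epsilon> where s: "s = local_nbhd J h r \<epsilon>" "h \<in> graph_classes J" "\<epsilon> > 0" by blast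
    then have "g \<in> graph_classes J" using Basis by (simp add: local_nbhd_def)
    then obtain G H where G: "G \<in> rooted_graphs J" "g = graph_iso J `` {G}"
      and H: "H \<in> rooted_graphs J" "h = graph_iso J `` {H}" using rep s by meson
    then obtain \<phi> where \<phi>: "ball_iso r H G \<phi>" "marks_within J r \<epsilon> H G \<phi>"
      using Basis s local_nbhd_class_iff[OF J H(1) G(1)] by auto
    obtain \<delta> where \<delta>: "\<delta> > 0" "marks_within J r (\<epsilon> - \<delta>) H G \<phi>"
      using marks_within_slack[OF J H(1) \<phi>(2) s(3)] by blast
    have "local_nbhd J g r \<delta> \<subseteq> s"
    proof
      fix k assume k: "k \<in> local_nbhd J g r \<delta>"
      then have "k \<in> graph_classes J" by (simp add: local_nbhd_def)
      then obtain K where K: "K \<in> rooted_graphs J" "k = graph_iso J `` {K}" using rep by meson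
      then obtain \<psi> where \<psi>: "ball_iso r G K \<psi>" "marks_within J r \<delta> G K \<psi>"
        using k G local_nbhd_class_iff[OF J G(1) K(1) \<delta>(1)] by auto
      have "marks_within J r ((\<epsilon> - \<delta>) + \<delta>) H K (\<psi> \<circ> \<phi>)"
        using marks_within_comp[OF \<phi>(1) \<delta>(2) \<psi>(2)] .
      then show "k \<in> s"
        using ball_iso_comp[OF \<phi>(1) \<psi>(1)] local_nbhd_class_iff[OF J H(1) K(1) s(3)] s K H by auto
    qed
    then show ?case using \<delta> by blast
  qed
qed

lemma limitin_local_topology:
  fixes Gs :: "nat \<Rightarrow> 'j marked_graph"
  assumes J: "finite J" and G: "G \<in> rooted_graphs J" and Gs: "\<And>n. Gs n \<in> rooted_graphs J"
  shows "limitin (local_topology J) (\<lambda>n. graph_iso J `` {Gs n}) (graph_iso J `` {G}) sequentially \<longleftrightarrow>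
    (\<forall>r. \<exists>\<phi>. (\<forall>\<^sub>F n in sequentially. ball_iso r G (Gs n) (\<phi> n)) \<and>
       (\<forall>\<epsilon>>0. \<forall>\<^sub>F n in sequentially. marks_within J r \<epsilon> G (Gs n) (\<phi> n)))"
    (is "?lim \<longleftrightarrow> (\<forall>r. ?conv r)")
proof
  assume lim: ?lim
  show "\<forall>r. ?conv r"
  proof
    fix r
    define P where "P n \<epsilon> \<phi> \<longleftrightarrow> ball_iso r G (Gs n) \<phi> \<and> marks_within J r \<epsilon> G (Gs n) \<phi>" for n \<epsilon> \<phi>
    have ev: "\<forall>\<^sub>F n in sequentially. \<exists>\<phi>. P n \<epsilon> \<phi>" if "\<epsilon> > 0" for \<epsilon>
    proof -
      have "openin (local_topology J) (local_nbhd J (graph_iso J `` {G}) r \<epsilon>)"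
        unfolding local_topology_def
        by (rule topology_generated_by_Basis, rule CollectI, intro exI conjI, rule refl)
          (use class_mem(1)[OF G] that in simp_all)
      moreover have "graph_iso J `` {G} \<in> local_nbhd J (graph_iso J `` {G}) r \<epsilon>"
        unfolding local_nbhd_class_iff[OF J G G that]
        by (intro exI[of _ "\<lambda>x. x"]) (simp add: marks_within_def ball_iso_id that)
      ultimately have "\<forall>\<^sub>F n in sequentially.
          graph_iso J `` {Gs n} \<in> local_nbhd J (graph_iso J `` {G}) r \<epsilon>"
        using lim by (simp add: limitin_def)
      then show ?thesis
        by (rule eventually_mono) (simp add: P_def local_nbhd_class_iff[OF J G Gs that])
    qed
    define m where "m n = (GREATEST m. m \<le> n \<and> (\<exists>\<phi>. P n (1 / Suc m) \<phi>))" for n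
    define \<phi> where "\<phi> n = (SOME \<phi>. P n (1 / Suc (m n)) \<phi>)" for n
    have main: "P n (1 / Suc k) (\<phi> n)" if k: "k \<le> n" "\<exists>\<phi>. P n (1 / Suc k) \<phi>" for n k
    proof -
      let ?Q = "\<lambda>m. m \<le> n \<and> (\<exists>\<phi>. P n (1 / Suc m) \<phi>)"
      have "?Q (m n)" unfolding m_def
        using k by (intro GreatestI_nat[where P = ?Q and b = n]) auto
      then have "\<exists>\<phi>. P n (1 / Suc (m n)) \<phi>" by simp
      then have "P n (1 / Suc (m n)) (\<phi> n)" unfolding \<phi>_def by (rule someI_ex)
      moreover have "k \<le> m n" unfolding m_def
        using k by (intro Greatest_le_nat[where P = ?Q and b = n]) auto
      then have "1 / real (Suc (m n)) \<le> 1 / real (Suc k)" by (simp add: frac_le)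
      ultimately show ?thesis unfolding P_def using marks_within_mono by blast
    qed
    have ev': "\<forall>\<^sub>F n in sequentially. P n (1 / Suc k) (\<phi> n)" for k
    proof -
      have "\<forall>\<^sub>F n in sequentially. \<exists>\<phi>. P n (1 / Suc k) \<phi>" by (rule ev) simp
      then show ?thesis
        using eventually_ge_at_top[of k] by eventually_elim (rule main)
    qed
    show "?conv r"
    proof (intro exI[of _ \<phi>] conjI allI impI)
      show "\<forall>\<^sub>F n in sequentially. ball_iso r G (Gs n) (\<phi> n)"
        using ev'[of 0] by (rule eventually_mono) (simp add: P_def)
      fix \<epsilon> :: real assume "\<epsilon> > 0"
      then obtain k where k: "1 / real (Suc k) < \<epsilon>"
        by (metis nat_approx_posE)
      show "\<forall>\<^sub>F n in sequentially. marks_within J r \<epsilon> G (Gs n) (\<phi> n)"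
        using ev'[of k]
        by (rule eventually_mono) (use k in \<open>auto simp: P_def intro: marks_within_mono less_imp_le\<close>)
    qed
  qed
next
  assume conv: "\<forall>r. ?conv r"
  show ?lim
    unfolding limitin_def
  proof (intro conjI allI impI)
    show "graph_iso J `` {G} \<in> topspace (local_topology J)" using class_mem[OF G] by simp
    fix U assume "openin (local_topology J) U \<and> graph_iso J `` {G} \<in> U"
    then obtain r \<epsilon> where r: "\<epsilon> > 0" "local_nbhd J (graph_iso J `` {G}) r \<epsilon> \<subseteq> U"
      using local_topology_nbhd_base[OF J] by blast
    obtain \<phi> where "\<forall>\<^sub>F n in sequentially. ball_iso r G (Gs n) (\<phi> n)"
      "\<forall>\<^sub>F n in sequentially. marks_within J r \<epsilon> G (Gs n) (\<phi> n)"
      using conv r(1) by blast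
    then show "\<forall>\<^sub>F n in sequentially. graph_iso J `` {Gs n} \<in> U"
    proof eventually_elim
      case (elim n)
      then show ?case using r local_nbhd_class_iff[OF J G Gs r(1)] by blast
    qed
  qed
qed

end

theory Submission
  imports Defs
begin

text \<open>
  A map \<open>\<phi>\<close> contributes to $\tau_{(G,o)}[H]$ only if it sends edges of \<open>H\<close> to edges of \<open>G\<close>. As \<open>H\<close> is
  finite and connected, such a \<open>\<phi>\<close> takes values in the ball of radius \<open>R\<close> around the root, with \<open>R\<close>
  depending only on \<open>H\<close>. Hence $\tau_{(G,o)}[H]$ is a polynomial in the finitely many marks of this
  ball; a ball isomorphism onto a nearby graph carries the index set of the sum along and
  moves the marks only slightly.
\<close>

section \<open>Continuity of sums of products\<close>

text \<open>A sum of products is continuous in its entries. Negating the claim at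
  \<open>\<delta> = 1 / (n + 1)\<close> for every \<open>n\<close> yields families that tend to
  \<open>z\<close> while the values stay \<open>\<epsilon>\<close> away, so limit rules replace an
  explicit estimate.\<close>

lemma sum_prod_perturbation:
  fixes z :: "'s \<Rightarrow> 'a \<Rightarrow> complex"
  assumes "\<epsilon> > 0"
  shows "\<exists>\<delta>>0. \<forall>w. (\<forall>s\<in>S. \<forall>a\<in>A. cmod (w s a - z s a) < \<delta>) \<longrightarrow>
           cmod ((\<Sum>s\<in>S. \<Prod>a\<in>A. w s a) - (\<Sum>s\<in>S. \<Prod>a\<in>A. z s a)) < \<epsilon>"
    (is "\<exists>\<delta>>0. \<forall>w. _ \<longrightarrow> cmod (?F w - ?F z) < \<epsilon>")
proof (rule ccontr)
  assume neg: "\<not> ?thesis"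
  have "\<exists>w. (\<forall>s\<in>S. \<forall>a\<in>A. cmod (w s a - z s a) < 1 / real (Suc n)) \<and> \<epsilon> \<le> cmod (?F w - ?F z)" for n
    using neg by (metis not_less zero_less_divide_1_iff of_nat_0_less_iff zero_less_Suc)
  then obtain w where w: "\<And>n s a. s \<in> S \<Longrightarrow> a \<in> A \<Longrightarrow> cmod (w n s a - z s a) < 1 / real (Suc n)"
    and far: "\<And>n. \<epsilon> \<le> cmod (?F (w n) - ?F z)" by metis
  have "(\<lambda>n. w n s a) \<longlonglongrightarrow> z s a" if "s \<in> S" "a \<in> A" for s a
    using LIMSEQ_norm_0[of "\<lambda>n. w n s a - z s a"] w[OF that] by (simp add: LIM_zero_iff)
  then have "(\<lambda>n. ?F (w n)) \<longlonglongrightarrow> ?F z" by (intro tendsto_sum tendsto_prod)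
  then have "\<forall>\<^sub>F n in sequentially. cmod (?F (w n) - ?F z) < \<epsilon>"
    using assms by (simp add: tendsto_iff dist_norm)
  then show False using far by (auto simp: eventually_sequentially not_less[symmetric])
qed

section \<open>Confining the maps to a ball\<close>

text \<open>Orientation is forgotten because connectedness of a test graph means reachability in its
  symmetrized digraph, and marked graphs are undirected.\<close>

definition tg_adj :: "'j test_graph \<Rightarrow> (nat \<times> nat) set" where
  "tg_adj H = (\<Union>e\<in>arcs (tg_graph H).
     {(tail (tg_graph H) e, head (tg_graph H) e), (head (tg_graph H) e, tail (tg_graph H) e)})"

text \<open>Connectedness gives a walk from the root to each vertex; the vertices are finite in
  number, so the chosen lengths have a maximum. This \<open>R\<close> depends on the test graph
  alone.\<close>

lemma test_graph_radius:
  assumes "H \<in> test_graphs J"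
  shows "\<exists>R. \<forall>v\<in>verts (tg_graph H). \<exists>k\<le>R. (tg_root H, v) \<in> tg_adj H ^^ k"
proof -
  let ?V = "verts (tg_graph H)"
  interpret fin_digraph "tg_graph H" using assms by (simp add: test_graphs_def)
  have "\<exists>k. (tg_root H, v) \<in> tg_adj H ^^ k" if v: "v \<in> ?V" for v
  proof -
    have "tg_root H \<rightarrow>\<^sup>*\<^bsub>with_proj (mk_symmetric (tg_graph H))\<^esub> v"
      using assms v by (simp add: test_graphs_def connected_def strongly_connected_def)
    then have "(tg_root H, v) \<in> (arcs_ends (with_proj (mk_symmetric (tg_graph H))))\<^sup>*"
      unfolding reachable_def by (rule rtrancl_on_rtranclI)
    moreover have "arcs_ends (with_proj (mk_symmetric (tg_graph H))) = tg_adj H"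
      by (simp add: parcs_mk_symmetric tg_adj_def)
    ultimately show ?thesis by (simp add: rtrancl_power)
  qed
  then obtain k where k: "\<And>v. v \<in> ?V \<Longrightarrow> (tg_root H, v) \<in> tg_adj H ^^ k v" by metis
  have "k v \<le> Max (k ` ?V)" if "v \<in> ?V" for v using that by simp
  then show ?thesis using k by blast
qed

text \<open>Adjacency in \<open>G\<close> is symmetric, so the image of a walk can follow arcs in
  either direction. The head comes first to match the argument order of the marks in
  \<open>rooted_tau\<close>.\<close>

lemma hom_relpow:
  assumes "\<And>e. e \<in> arcs (tg_graph H) \<Longrightarrow>
      (\<phi> (head (tg_graph H) e), \<phi> (tail (tg_graph H) e)) \<in> adj G"
    and "(x, y) \<in> tg_adj H ^^ k"
  shows "(\<phi> x, \<phi> y) \<in> adj G ^^ k"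
  using assms(2)
proof (induction k arbitrary: y)
  case (Suc k)
  then obtain w where w: "(x, w) \<in> tg_adj H ^^ k" "(w, y) \<in> tg_adj H" by auto
  then have "(\<phi> w, \<phi> y) \<in> adj G"
    using assms(1) by (auto simp: tg_adj_def adj_def insert_commute)
  then show ?case using Suc.IH[OF w(1)] by auto
qed simp

definition ball_maps :: "nat \<Rightarrow> 'j marked_graph \<Rightarrow> 'j test_graph \<Rightarrow> (nat \<Rightarrow> nat) set" where
  "ball_maps r G H = {\<phi> \<in> verts (tg_graph H) \<rightarrow>\<^sub>E gball G r. \<phi> (tg_root H) = root G}"

lemma finite_ball_maps:
  assumes "G \<in> rooted_graphs J" "H \<in> test_graphs J"
  shows "finite (ball_maps r G H)"
proof -
  interpret fin_digraph "tg_graph H" using assms by (simp add: test_graphs_def)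
  have "finite (verts (tg_graph H) \<rightarrow>\<^sub>E gball G r)"
    using finite_gball[OF assms(1)] by (intro finite_PiE) auto
  then show ?thesis by (rule rev_finite_subset) (auto simp: ball_maps_def)
qed

lemma mark_eps_nonadj:
  assumes "G \<in> rooted_graphs J" "j \<in> J" "x \<in> vertices G" "y \<in> vertices G" "{x, y} \<notin> edges G"
  shows "mark_eps G s j x y = 0"
proof -
  have zero: "mark G j u v = 0" if "u \<in> vertices G" "v \<in> vertices G" "{u, v} \<notin> edges G" for u v
    using assms(1,2) that unfolding rooted_graphs_def by blast
  have "{y, x} \<notin> edges G" using assms(5) by (simp add: insert_commute)
  then show ?thesis using zero assms(3-5) by (simp add: mark_eps_def)
qed

text \<open>In a non-zero term every arc goes to an edge of \<open>G\<close>. Walks of length at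
  most \<open>R\<close> from the root of \<open>H\<close> then become walks from
  \<open>root G\<close>, which forces the map into the ball.\<close>

lemma rooted_tau_eq_ball_sum:
  assumes G: "G \<in> rooted_graphs J" and H: "H \<in> test_graphs J"
    and R: "\<forall>v\<in>verts (tg_graph H). \<exists>k\<le>R. (tg_root H, v) \<in> tg_adj H ^^ k"
  shows "rooted_tau G H = (\<Sum>\<phi>\<in>ball_maps R G H. \<Prod>e\<in>arcs (tg_graph H).
           mark_eps G (tg_star H e) (tg_label H e)
             (\<phi> (head (tg_graph H) e)) (\<phi> (tail (tg_graph H) e)))"
    (is "_ = (\<Sum>\<phi>\<in>_. ?term \<phi>)")
proof -
  interpret fin_digraph "tg_graph H" using H by (simp add: test_graphs_def)
  have lab: "\<And>e. e \<in> arcs (tg_graph H) \<Longrightarrow> tg_label H e \<in> J"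
    using H by (auto simp: test_graphs_def)
  have zero: "?term \<phi> = 0" if \<phi>: "\<phi> \<in> verts (tg_graph H) \<rightarrow>\<^sub>E vertices G" "\<phi> (tg_root H) = root G"
      and out: "\<phi> \<notin> ball_maps R G H" for \<phi>
  proof (rule ccontr)
    assume nz: "?term \<phi> \<noteq> 0"
    have hom: "(\<phi> (head (tg_graph H) e), \<phi> (tail (tg_graph H) e)) \<in> adj G"
      if e: "e \<in> arcs (tg_graph H)" for e
    proof (rule ccontr)
      assume "\<not> ?thesis"
      moreover have "\<phi> (head (tg_graph H) e) \<in> vertices G" "\<phi> (tail (tg_graph H) e) \<in> vertices G"
        using \<phi>(1) e by auto
      ultimately have "mark_eps G (tg_star H e) (tg_label H e)
             (\<phi> (head (tg_graph H) e)) (\<phi> (tail (tg_graph H) e)) = 0"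
        using mark_eps_nonadj[OF G lab[OF e]] by (simp add: adj_def)
      \<comment> \<open>Since \<open>H\<close> has finitely many arcs, one zero factor makes the
        product zero.\<close>
      then show False using nz e by auto
    qed
    have "\<phi> v \<in> gball G R" if v: "v \<in> verts (tg_graph H)" for v
      using bspec[OF R v] hom_relpow[where \<phi> = \<phi>, OF hom] \<phi>(2) by (fastforce simp: gball_def)
    then show False using \<phi> out by (auto simp: ball_maps_def PiE_def)
  qed
  have "rooted_tau G H = infsum ?term (ball_maps R G H)"
    unfolding rooted_tau_def
  proof (rule infsum_cong_neutral)
    fix \<phi> assume "\<phi> \<in> {\<phi> \<in> verts (tg_graph H) \<rightarrow>\<^sub>E vertices G. \<phi> (tg_root H) = root G} - ball_maps R G H"
    then show "?term \<phi> = 0" using zero by blast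
  next
    \<comment> \<open>This difference is empty, because the ball lies inside
      \<open>vertices G\<close>.\<close>
    fix \<phi> assume "\<phi> \<in> ball_maps R G H - {\<phi> \<in> verts (tg_graph H) \<rightarrow>\<^sub>E vertices G. \<phi> (tg_root H) = root G}"
    then show "?term \<phi> = 0" using gball_subset[OF G, of R] by (auto simp: ball_maps_def PiE_def Pi_def)
  qed simp
  then show ?thesis using infsum_finite[OF finite_ball_maps[OF G H]] by simp
qed

section \<open>Comparison along a ball isomorphism\<close>

text \<open>Composition with the inverse of \<open>\<psi>\<close> undoes composition with
  \<open>\<psi>\<close>; \<open>restrict\<close> brings the composites back to extensional
  functions, so that the two maps are inverse on the nose.\<close>

lemma bij_betw_ball_maps:
  assumes iso: "ball_iso r G G' \<psi>" and H: "H \<in> test_graphs J"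
  shows "bij_betw (\<lambda>\<phi>. restrict (\<psi> \<circ> \<phi>) (verts (tg_graph H))) (ball_maps r G H) (ball_maps r G' H)"
proof -
  let ?i = "inv_into (gball G r) \<psi>" and ?V = "verts (tg_graph H)"
  have b: "bij_betw \<psi> (gball G r) (gball G' r)" using iso by (simp add: ball_iso_def)
  have roots: "\<psi> (root G) = root G'" "?i (root G') = root G"
    using iso ball_iso_inv[OF iso] by (simp_all add: ball_iso_def)
  have root: "tg_root H \<in> ?V" using H by (simp add: test_graphs_def)
  note l = bij_betw_inv_into_left[OF b] and r = bij_betw_inv_into_right[OF b]
  have m: "\<psi> x \<in> gball G' r" if "x \<in> gball G r" for x using that b by (auto simp: bij_betw_def)
  have m': "?i x \<in> gball G r" if "x \<in> gball G' r" for x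
    using that bij_betw_inv_into[OF b] by (auto simp: bij_betw_def)
  show ?thesis
  proof (rule bij_betw_byWitness[where f' = "\<lambda>\<phi>. restrict (?i \<circ> \<phi>) ?V"])
    show "\<forall>\<phi>\<in>ball_maps r G H. restrict (?i \<circ> restrict (\<psi> \<circ> \<phi>) ?V) ?V = \<phi>"
      by (auto simp: ball_maps_def fun_eq_iff restrict_def PiE_def Pi_def extensional_def l)
    show "\<forall>\<phi>\<in>ball_maps r G' H. restrict (\<psi> \<circ> restrict (?i \<circ> \<phi>) ?V) ?V = \<phi>"
      by (auto simp: ball_maps_def fun_eq_iff restrict_def PiE_def Pi_def extensional_def r)
  qed (use root roots m m' in \<open>auto simp: ball_maps_def PiE_iff\<close>)
qed

lemma rooted_tau_locally_close:
  assumes G: "G \<in> rooted_graphs J" and H: "H \<in> test_graphs J" and "\<epsilon> > 0"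
  obtains r \<delta> where "\<delta> > 0"
    "\<And>G' \<psi>. G' \<in> rooted_graphs J \<Longrightarrow> ball_iso r G G' \<psi> \<Longrightarrow> marks_within J r \<delta> G G' \<psi> \<Longrightarrow>
       cmod (rooted_tau G' H - rooted_tau G H) < \<epsilon>"
proof -
  let ?A = "arcs (tg_graph H)" and ?h = "head (tg_graph H)" and ?t = "tail (tg_graph H)"
  interpret fin_digraph "tg_graph H" using H by (simp add: test_graphs_def)
  obtain R where R: "\<forall>v\<in>verts (tg_graph H). \<exists>k\<le>R. (tg_root H, v) \<in> tg_adj H ^^ k"
    using test_graph_radius[OF H] by blast
  let ?z = "\<lambda>\<phi> e. mark_eps G (tg_star H e) (tg_label H e) (\<phi> (?h e)) (\<phi> (?t e))"
  \<comment> \<open>Fixed from the marks of \<open>G\<close> alone, hence uniform in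
    \<open>G'\<close> and \<open>\<psi>\<close>.\<close>
  obtain \<delta> where \<delta>: "\<delta> > 0"
    "\<forall>w. (\<forall>\<phi>\<in>ball_maps R G H. \<forall>e\<in>?A. cmod (w \<phi> e - ?z \<phi> e) < \<delta>) \<longrightarrow>
       cmod ((\<Sum>\<phi>\<in>ball_maps R G H. \<Prod>e\<in>?A. w \<phi> e) - (\<Sum>\<phi>\<in>ball_maps R G H. \<Prod>e\<in>?A. ?z \<phi> e)) < \<epsilon>"
    using sum_prod_perturbation[OF \<open>\<epsilon> > 0\<close>, where z = ?z] by blast
  have "cmod (rooted_tau G' H - rooted_tau G H) < \<epsilon>"
    if G': "G' \<in> rooted_graphs J" and iso: "ball_iso R G G' \<psi>" and mw: "marks_within J R \<delta> G G' \<psi>"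
    for G' \<psi>
  proof -
    \<comment> \<open>The marks of \<open>G'\<close> pulled back along \<open>\<psi>\<close>, so
      that both sums run over the ball maps of \<open>G\<close>.\<close>
    let ?w = "\<lambda>\<phi> e. mark_eps G' (tg_star H e) (tg_label H e) (\<psi> (\<phi> (?h e))) (\<psi> (\<phi> (?t e)))"
    have "rooted_tau G' H = (\<Sum>\<phi>\<in>ball_maps R G H. \<Prod>e\<in>?A. ?w \<phi> e)"
      unfolding rooted_tau_eq_ball_sum[OF G' H R]
      by (subst sum.reindex_bij_betw[OF bij_betw_ball_maps[OF iso H], symmetric])
        (intro sum.cong prod.cong; simp)
    moreover have "cmod (?w \<phi> e - ?z \<phi> e) < \<delta>" if \<phi>: "\<phi> \<in> ball_maps R G H" and e: "e \<in> ?A" for \<phi> e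
    proof -
      have j: "tg_label H e \<in> J" using H e by (auto simp: test_graphs_def)
      have x: "\<phi> (?h e) \<in> gball G R" "\<phi> (?t e) \<in> gball G R"
        using \<phi> e by (auto simp: ball_maps_def)
      have close: "cmod (mark G' (tg_label H e) (\<psi> u) (\<psi> v) - mark G (tg_label H e) u v) < \<delta>"
        if u: "u \<in> gball G R" and v: "v \<in> gball G R" for u v
      proof (cases "{u, v} \<in> edges G")
        case True
        then show ?thesis using mw j u v by (simp add: marks_within_def)
      next
        \<comment> \<open>\<open>marks_within\<close> says nothing about non-edges;
          \<open>\<psi>\<close> sends them to non-edges, so both marks are 0.\<close>
        case False
        then have "{\<psi> u, \<psi> v} \<notin> edges G'" using iso u v by (simp add: ball_iso_def)
        moreover have "\<psi> u \<in> vertices G'" "\<psi> v \<in> vertices G'" "u \<in> vertices G" "v \<in> vertices G"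
          using iso u v gball_subset[OF G', of R] gball_subset[OF G, of R]
          by (auto simp: ball_iso_def bij_betw_def)
        ultimately show ?thesis
          using False \<delta>(1) mark_eps_nonadj[OF G j, of u v False]
            mark_eps_nonadj[OF G' j, of "\<psi> u" "\<psi> v" False]
          by (simp add: mark_eps_def)
      qed
      show ?thesis
      proof (cases "tg_star H e")
        \<comment> \<open>A starred edge swaps the arguments and conjugates, which leaves the
          modulus unchanged.\<close>
        case True
        then have "cmod (?w \<phi> e - ?z \<phi> e) =
            cmod (cnj (mark G' (tg_label H e) (\<psi> (\<phi> (?t e))) (\<psi> (\<phi> (?h e)))
              - mark G (tg_label H e) (\<phi> (?t e)) (\<phi> (?h e))))"
          by (simp add: mark_eps_def)
        then show ?thesis unfolding complex_mod_cnj using close[OF x(2,1)] by simp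
      qed (use close[OF x] in \<open>simp add: mark_eps_def\<close>)
    qed
    ultimately show ?thesis using spec[OF \<delta>(2), of ?w] rooted_tau_eq_ball_sum[OF G H R] by simp
  qed
  then show ?thesis using that \<delta>(1) by blast
qed

lemma tau_class_tendsto:
  assumes J: "finite J" and g: "g \<in> graph_classes J" and h: "h \<in> test_classes J"
  shows "((\<lambda>g. tau_class g h) \<longlongrightarrow> tau_class g h) (atin (local_topology J) g)"
  unfolding tendsto_iff
proof (intro allI impI)
  fix \<epsilon> :: real assume "\<epsilon> > 0"
  obtain G where G: "G \<in> rooted_graphs J" "g = graph_iso J `` {G}"
    using g by (auto simp: graph_classes_def quotient_def)
  obtain H where H: "H \<in> test_graphs J" "H \<in> h"
    using h equiv_class_self[OF equiv_test_iso] by (auto simp: test_classes_def quotient_def)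
  obtain r \<delta> where \<delta>: "\<delta> > 0"
    "\<And>G' \<psi>. G' \<in> rooted_graphs J \<Longrightarrow> ball_iso r G G' \<psi> \<Longrightarrow> marks_within J r \<delta> G G' \<psi> \<Longrightarrow>
       cmod (rooted_tau G' H - rooted_tau G H) < \<epsilon>"
    using rooted_tau_locally_close[OF G(1) H(1) \<open>\<epsilon> > 0\<close>] by metis
  let ?U = "local_nbhd J g r \<delta>"
  have "openin (local_topology J) ?U"
    unfolding local_topology_def using g \<delta>(1) by (intro topology_generated_by_Basis) blast
  moreover have "g \<in> ?U"
    unfolding G(2) local_nbhd_class_iff[OF J G(1) G(1) \<delta>(1)]
    by (intro exI[of _ "\<lambda>x. x"]) (simp add: marks_within_def ball_iso_id \<delta>(1))
  moreover have "dist (tau_class g' h) (tau_class g h) < \<epsilon>" if "g' \<in> ?U" for g'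
  proof -
    have g': "g' \<in> graph_classes J" using that by (simp add: local_nbhd_def)
    then obtain G' where G': "G' \<in> rooted_graphs J" "g' = graph_iso J `` {G'}"
      by (auto simp: graph_classes_def quotient_def)
    \<comment> \<open>Membership in \<open>?U\<close> only provides some representatives;
      \<open>local_nbhd_class_iff\<close> yields an isomorphism between the balls of the chosen
      \<open>G\<close> and \<open>G'\<close>.\<close>
    obtain \<psi> where "ball_iso r G G' \<psi>" "marks_within J r \<delta> G G' \<psi>"
      using \<open>g' \<in> ?U\<close> unfolding G(2) G'(2) local_nbhd_class_iff[OF J G(1) G'(1) \<delta>(1)] by blast
    then have "cmod (rooted_tau G' H - rooted_tau G H) < \<epsilon>" using \<delta>(2) G'(1) by blast
    moreover have "G \<in> g" "G' \<in> g'" using G G' class_mem(2) by auto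
    ultimately show ?thesis
      using tau_class_eq[OF g _ h H(2)] tau_class_eq[OF g' _ h H(2)] by (simp add: dist_norm)
  qed
  ultimately show "\<forall>\<^sub>F g' in atin (local_topology J) g. dist (tau_class g' h) (tau_class g h) < \<epsilon>"
    unfolding eventually_atin by blast
qed

section \<open>Linearity and continuity of \<open>tau_hat\<close>\<close>

text \<open>Allows a common index set for \<open>p\<close>, \<open>q\<close> and
  \<open>p + q\<close>, whose keys differ when coefficients cancel. The added terms have coefficient
  0.\<close>

lemma tau_hat_superset:
  assumes "p \<in> test_space J" "finite K" "Poly_Mapping.keys p \<subseteq> K"
  shows "tau_hat J g p = (\<Sum>h\<in>K. Poly_Mapping.lookup p h * tau_class g h)"
proof -
  have "tau_hat J g p = (\<Sum>h\<in>Poly_Mapping.keys p. Poly_Mapping.lookup p h * tau_class g h)"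
    using assms(1) by (simp add: tau_hat_def)
  also have "\<dots> = (\<Sum>h\<in>K. Poly_Mapping.lookup p h * tau_class g h)"
    using assms by (intro sum.mono_neutral_left) (auto simp: in_keys_iff)
  finally show ?thesis .
qed

lemma tau_hat_in_dual: "tau_hat J g \<in> traf_dual J"
  unfolding traf_dual_def
proof (intro CollectI conjI ballI allI)
  show "tau_hat J g \<in> extensional (test_space J)" by (simp add: tau_hat_def)
next
  fix p q assume pq: "p \<in> test_space J" "q \<in> test_space J"
  let ?K = "Poly_Mapping.keys p \<union> Poly_Mapping.keys q"
  have k: "Poly_Mapping.keys (p + q) \<subseteq> ?K" by (rule Poly_Mapping.keys_add)
  then have "p + q \<in> test_space J" using pq unfolding test_space_def by blast
  then show "tau_hat J g (p + q) = tau_hat J g p + tau_hat J g q"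
    using pq k by (simp add: tau_hat_superset[where K = ?K] lookup_add distrib_right sum.distrib)
next
  fix c p assume p: "p \<in> test_space J"
  let ?q = "Poly_Mapping.map ((*) c) p" and ?K = "Poly_Mapping.keys p"
  have l: "Poly_Mapping.lookup ?q h = c * Poly_Mapping.lookup p h" for h
    by (simp add: Poly_Mapping.map.rep_eq when_def)
  \<comment> \<open>Equality can fail: for \<open>c = 0\<close> all keys disappear.\<close>
  then have k: "Poly_Mapping.keys ?q \<subseteq> ?K" by (auto simp: in_keys_iff)
  then have "?q \<in> test_space J" using p unfolding test_space_def by blast
  then show "tau_hat J g ?q = c * tau_hat J g p"
    using p k by (simp add: tau_hat_superset[where K = ?K] l sum_distrib_left mult.assoc)
qed

theorem lemma6p2:
  fixes J :: "'j set"
  assumes "finite J"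
  shows "continuous_map (local_topology J) (traf_topology J) (tau_hat J)"
proof -
  \<comment> \<open>Pointwise convergence reduces continuity to each fixed \<open>p\<close>, where
    \<open>tau_hat\<close> is a finite linear combination of the functions
    \<open>tau_class\<close>.\<close>
  have "continuous_map (local_topology J) euclidean (\<lambda>g. tau_hat J g p)" if p: "p \<in> test_space J" for p
    unfolding continuous_map_atin
  proof (intro ballI)
    fix g assume "g \<in> topspace (local_topology J)"
    then have "((\<lambda>g. \<Sum>h\<in>Poly_Mapping.keys p. Poly_Mapping.lookup p h * tau_class g h) \<longlongrightarrow>
        (\<Sum>h\<in>Poly_Mapping.keys p. Poly_Mapping.lookup p h * tau_class g h)) (atin (local_topology J) g)"
      using p by (intro tendsto_sum tendsto_mult tendsto_const tau_class_tendsto[OF assms])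
        (auto simp: test_space_def)
    then show "limitin euclidean (\<lambda>g. tau_hat J g p) (tau_hat J g p) (atin (local_topology J) g)"
      using p by (simp add: tau_hat_def)
  qed
  \<comment> \<open>Besides continuity of each coordinate, the product criterion asks for
    extensional values, which membership in \<open>traf_dual J\<close> includes.\<close>
  then show ?thesis
    unfolding traf_topology_def continuous_map_in_subtopology continuous_map_componentwise
    using tau_hat_in_dual by (auto simp: traf_dual_def)
qed

end
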